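(* For every real number $\epsilon < \frac{2}{3}$ there exist a constant $c > 0$ and win-lose bimatrix games with $m \le n$ and $n$ arbitrarily large such that, in each of these games, every $\epsilon$-well-supported Nash equilibrium $(\mathbf{p}, \mathbf{q})$ satisfies $\max(|\mathrm{supp}(\mathbf{p})|, |\mathrm{supp}(\mathbf{q})|) \ge c \sqrt[3]{\log n}$. That is, every $\epsilon$-well-supported Nash equilibrium has supports of cardinality $\Omega(\sqrt[3]{\log n})$.
   Context: A bimatrix game is given by two $m \times n$ payoff matrices $A$ (row player) and $B$ (column player), with $m \le n$. It is win-lose if all entries of $A$ and $B$ lie in $\{0,1\}$. A pair of mixed strategies $(\mathbf{p}, \mathbf{q})$ (probability vectors over rows and columns, respectively) is an $\epsilon$-well-supported Nash equilibrium if every row $i$ in the support of $\mathbf{p}$ satisfies $\mathbf{e}_i^T A \mathbf{q} \ge \max_\ell \mathbf{e}_\ell^T A \mathbf{q} - \epsilon$, and every column $j$ in the support of $\mathbf{q}$ satisfies $\mathbf{p}^T B \mathbf{e}_j \ge \max_\ell \mathbf{p}^T B \mathbf{e}_\ell - \epsilon$. Here $\mathrm{supp}$ denotes the support, i.e. the set of pure strategies played with positive probability. *)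

theory Defs
  imports "HOL-Analysis.Analysis"
begin

text \<open>An m x n bimatrix game: payoff matrices are functions nat => nat => real,
  only the entries with row index < m and column index < n are relevant.
  Rows are indexed by {..<m}, columns by {..<n}.\<close>

definition win_lose :: "nat \<Rightarrow> nat \<Rightarrow> (nat \<Rightarrow> nat \<Rightarrow> real) \<Rightarrow> (nat \<Rightarrow> nat \<Rightarrow> real) \<Rightarrow> bool" where
  "win_lose m n A B \<longleftrightarrow>
     (\<forall>i<m. \<forall>j<n. A i j \<in> {0, 1} \<and> B i j \<in> {0, 1})"

definition mixed_strategy :: "nat \<Rightarrow> (nat \<Rightarrow> real) \<Rightarrow> bool" where
  "mixed_strategy k p \<longleftrightarrow> (\<forall>i<k. 0 \<le> p i) \<and> (\<Sum>i<k. p i) = 1 \<and> (\<forall>i\<ge>k. p i = 0)"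

definition supp :: "nat \<Rightarrow> (nat \<Rightarrow> real) \<Rightarrow> nat set" where
  "supp k p = {i. i < k \<and> p i > 0}"

definition row_payoff :: "nat \<Rightarrow> (nat \<Rightarrow> nat \<Rightarrow> real) \<Rightarrow> (nat \<Rightarrow> real) \<Rightarrow> nat \<Rightarrow> real" where
  "row_payoff n A q i = (\<Sum>j<n. A i j * q j)"

definition col_payoff :: "nat \<Rightarrow> (nat \<Rightarrow> nat \<Rightarrow> real) \<Rightarrow> (nat \<Rightarrow> real) \<Rightarrow> nat \<Rightarrow> real" where
  "col_payoff m B p j = (\<Sum>i<m. p i * B i j)"

definition eps_WSNE ::
  "real \<Rightarrow> nat \<Rightarrow> nat \<Rightarrow> (nat \<Rightarrow> nat \<Rightarrow> real) \<Rightarrow> (nat \<Rightarrow> nat \<Rightarrow> real) \<Rightarrow> (nat \<Rightarrow> real) \<Rightarrow> (nat \<Rightarrow> real) \<Rightarrow> bool" where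
  "eps_WSNE \<epsilon> m n A B p q \<longleftrightarrow>
     mixed_strategy m p \<and> mixed_strategy n q \<and>
     (\<forall>i\<in>supp m p. \<forall>l<m. row_payoff n A q i \<ge> row_payoff n A q l - \<epsilon>) \<and>
     (\<forall>j\<in>supp n q. \<forall>l<n. col_payoff m B p j \<ge> col_payoff m B p l - \<epsilon>)"

end

theory Submission
  imports Defs
begin

text \<open>Take a tournament on \<open>16 ^ (k * k)\<close> vertices in which every set of at most \<open>k * k\<close> vertices is
  dominated. Rows are vertices, columns are \<open>k\<close>-tuples of vertices; the row player wins if the row
  beats every entry of the column, the column player wins if the row occurs in the column. Any
  at most \<open>k\<close> rows share a winning column, and any at most \<open>k\<close> columns share a winning row. Hence in an
  equilibrium with supports of size at most \<open>k\<close> both best-response payoffs are 1, and every strategy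
  played earns at least \<open>1 - \<epsilon> > 1/3\<close>. Read ``a wins against b'' as an arc from \<open>a\<close> to \<open>b\<close>: every vertex of this
  weighted bipartite digraph has out-weight more than \<open>1/3\<close>, which forces a closed walk of length 4,
  and such a walk gives two vertices of the tournament beating each other.\<close>

section \<open>Closed 4-walks in weighted bipartite digraphs\<close>

text \<open>The vertex \<open>i\<close> has the largest in-weight \<open>d\<close>. Let \<open>P\<close> be the set of vertices reached from \<open>i\<close> in two
  steps. The arcs leaving \<open>P\<close> avoid the in-neighbours of \<open>i\<close>. Their weight \<open>L * sum p P\<close> splits into
  the part that returns to the out-neighbours of \<open>i\<close>, at most \<open>L * (sum p P - L)\<close> since there are no
  2-cycles, and the rest, at most \<open>d * (1 - L - d)\<close> by the choice of \<open>d\<close>. So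
  \<open>L\<^sup>2 \<le> d * (1 - L - d)\<close>, which fails for \<open>L > 1/3\<close>.\<close>

lemma bipartite_max_indegree_contradiction:
  fixes p :: "'a \<Rightarrow> real" and q :: "'b \<Rightarrow> real" and f :: "'a \<Rightarrow> 'b \<Rightarrow> real" and g :: "'b \<Rightarrow> 'a \<Rightarrow> real"
  assumes fin: "finite S" "finite T"
    and p: "\<And>i. i \<in> S \<Longrightarrow> 0 \<le> p i" and q: "\<And>j. j \<in> T \<Longrightarrow> 0 \<le> q j" "sum q T = 1"
    and f: "\<And>i j. 0 \<le> f i j" and g: "\<And>j i. 0 \<le> g j i"
    and no2: "\<And>i j. i \<in> S \<Longrightarrow> j \<in> T \<Longrightarrow> f i j + g j i \<le> 1"
    and no4: "\<And>i j i' j'. i \<in> S \<Longrightarrow> j \<in> T \<Longrightarrow> i' \<in> S \<Longrightarrow> j' \<in> T \<Longrightarrow>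
      f i j * g j i' * f i' j' * g j' i = 0"
    and outf: "\<And>i. i \<in> S \<Longrightarrow> (\<Sum>j\<in>T. q j * f i j) = L"
    and outg: "\<And>j. j \<in> T \<Longrightarrow> (\<Sum>i\<in>S. p i * g j i) = L"
    and L: "L > 1/3"
    and i: "i \<in> S"
    and max: "\<And>j. j \<in> T \<Longrightarrow> (\<Sum>i'\<in>S. p i' * f i' j) \<le> (\<Sum>j\<in>T. q j * g j i)"
  shows False
proof -
  define d where "d = (\<Sum>j\<in>T. q j * g j i)"
  define P where "P = {i'\<in>S. \<exists>j\<in>T. f i j * g j i' > 0}"
  have P: "finite P" "P \<subseteq> S" using fin by (auto simp: P_def)
  have d0: "0 \<le> d" unfolding d_def by (intro sum_nonneg mult_nonneg_nonneg q g)
  \<comment> \<open>Every vertex reached by an arc out of an out-neighbour \<open>j\<close> of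
    \<open>i\<close> lies in \<open>P\<close> by definition, so the whole out-weight
    \<open>L\<close> of \<open>j\<close> goes into \<open>P\<close>.\<close>
  have closed: "(\<Sum>i'\<in>P. p i' * g j i') = L" if j: "j \<in> T" "f i j > 0" for j
  proof -
    have "(\<Sum>i'\<in>P. p i' * g j i') = (\<Sum>i'\<in>S. p i' * g j i')"
    proof (rule sum.mono_neutral_left[OF fin(1) P(2)], rule ballI)
      fix i' assume "i' \<in> S - P"
      then have "\<not> f i j * g j i' > 0" using j by (auto simp: P_def)
      then have "g j i' = 0" using g[of j i'] j(2) by (simp add: zero_less_mult_iff)
      then show "p i' * g j i' = 0" by simp
    qed
    then show ?thesis using outg j by simp
  qed
  have avoid: "f i' j' * g j' i = 0" if i': "i' \<in> P" and j': "j' \<in> T" for i' j'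
  proof -
    obtain j where j: "j \<in> T" "f i j * g j i' > 0" and "i' \<in> S" using i' by (auto simp: P_def)
    then show ?thesis using no4[OF i j(1) \<open>i' \<in> S\<close> j'] by auto
  qed
  \<comment> \<open>The cross term \<open>f i' j * g j i\<close> vanishes by \<open>avoid\<close>,
    so the splitting is exact.\<close>
  have split: "f i' j * f i j + f i' j * (1 - f i j - g j i) = f i' j" if "i' \<in> P" "j \<in> T" for i' j
    using avoid[OF that] by (simp add: algebra_simps)
  have inner: "(\<Sum>i'\<in>P. \<Sum>j\<in>T. p i' * q j * (f i' j * f i j)) \<le> L * sum p P - L * L"
  proof -
    have "(\<Sum>i'\<in>P. \<Sum>j\<in>T. p i' * q j * (f i' j * f i j))
        \<le> (\<Sum>i'\<in>P. \<Sum>j\<in>T. p i' * q j * ((1 - g j i') * f i j))"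
    proof (intro sum_mono mult_left_mono mult_right_mono)
      fix i' j assume "i' \<in> P" "j \<in> T"
      then have "i' \<in> S" using P by auto
      show "f i' j \<le> 1 - g j i'" using no2[OF \<open>i' \<in> S\<close> \<open>j \<in> T\<close>] by simp
      show "0 \<le> f i j" by (rule f)
      show "0 \<le> p i' * q j" using p q \<open>i' \<in> S\<close> \<open>j \<in> T\<close> by simp
    qed
    also have "\<dots> = (\<Sum>j\<in>T. \<Sum>i'\<in>P. p i' * q j * ((1 - g j i') * f i j))"
      by (rule sum.swap)
    also have "\<dots> = (\<Sum>j\<in>T. q j * f i j * (sum p P - (\<Sum>i'\<in>P. p i' * g j i')))"
      by (simp add: sum_distrib_left sum_distrib_right sum_subtractf algebra_simps)
    also have "\<dots> = (\<Sum>j\<in>T. q j * f i j * (sum p P - L))"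
    proof (rule sum.cong[OF refl])
      fix j assume "j \<in> T"
      then show "q j * f i j * (sum p P - (\<Sum>i'\<in>P. p i' * g j i')) = q j * f i j * (sum p P - L)"
        using closed[of j] f[of i j] by (cases "f i j = 0") auto
    qed
    also have "\<dots> = L * (sum p P - L)" by (simp add: sum_distrib_right[symmetric] outf[OF i])
    finally show ?thesis by (simp add: algebra_simps)
  qed
  have outer: "(\<Sum>i'\<in>P. \<Sum>j\<in>T. p i' * q j * (f i' j * (1 - f i j - g j i))) \<le> d * (1 - L - d)"
  proof -
    have "(\<Sum>i'\<in>P. \<Sum>j\<in>T. p i' * q j * (f i' j * (1 - f i j - g j i)))
        = (\<Sum>j\<in>T. q j * (1 - f i j - g j i) * (\<Sum>i'\<in>P. p i' * f i' j))"
      by (subst sum.swap) (simp add: sum_distrib_left mult_ac)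
    also have "\<dots> \<le> (\<Sum>j\<in>T. q j * (1 - f i j - g j i) * d)"
    proof (intro sum_mono mult_left_mono)
      fix j assume j: "j \<in> T"
      have "(\<Sum>i'\<in>P. p i' * f i' j) \<le> (\<Sum>i'\<in>S. p i' * f i' j)"
        by (rule sum_mono2[OF fin(1) P(2)]) (use p f in auto)
      also have "\<dots> \<le> d" using max[OF j] by (simp add: d_def)
      finally show "(\<Sum>i'\<in>P. p i' * f i' j) \<le> d" .
      show "0 \<le> q j * (1 - f i j - g j i)" using q j no2[OF i j] by simp
    qed
    also have "\<dots> = (sum q T - (\<Sum>j\<in>T. q j * f i j) - (\<Sum>j\<in>T. q j * g j i)) * d"
      by (simp add: sum_distrib_right[symmetric] sum_subtractf right_diff_distrib)
    also have "\<dots> = d * (1 - L - d)" using q outf[OF i] by (simp add: d_def)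
    finally show ?thesis .
  qed
  have "L * sum p P = (\<Sum>i'\<in>P. p i' * (\<Sum>j\<in>T. q j * f i' j))"
    using P(2) outf by (subst sum_distrib_left) (auto simp: mult.commute intro!: sum.cong)
  also have "\<dots> = (\<Sum>i'\<in>P. \<Sum>j\<in>T. p i' * q j * (f i' j * f i j + f i' j * (1 - f i j - g j i)))"
    by (simp add: split sum_distrib_left mult.assoc)
  also have "\<dots> = (\<Sum>i'\<in>P. \<Sum>j\<in>T. p i' * q j * (f i' j * f i j))
      + (\<Sum>i'\<in>P. \<Sum>j\<in>T. p i' * q j * (f i' j * (1 - f i j - g j i)))"
    by (simp add: sum.distrib distrib_left)
  finally have key: "L * L \<le> d * (1 - L - d)" using inner outer by linarith
  \<comment> \<open>From \<open>L > 1/3\<close> follows \<open>1 - L < 2 * L\<close>, and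
    \<open>d * (2 * L - d)\<close> is at most \<open>L * L\<close> by completing the square.
    Strictness requires \<open>d > 0\<close>.\<close>
  have "0 < L * L" using L by simp
  then have "d \<noteq> 0" using key by auto
  then have "d * (1 - L - d) < d * (2 * L - d)" using d0 L by (intro mult_strict_left_mono) auto
  also have "\<dots> = L * L - (d - L) * (d - L)" by (simp add: algebra_simps)
  finally show False using key zero_le_square[of "d - L"] by linarith
qed

text \<open>The vertex of largest in-weight may lie on either side; the preceding lemma treats
  \<open>S\<close>, and exchanging the two sides treats \<open>T\<close>. The walk may repeat
  vertices, so its absence also excludes 2-cycles.\<close>

theorem bipartite_closed_4_walk:
  fixes p :: "'a \<Rightarrow> real" and q :: "'b \<Rightarrow> real"
  assumes fin: "finite S" "finite T"
    and p: "\<And>i. i \<in> S \<Longrightarrow> 0 \<le> p i" "sum p S = 1"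
    and q: "\<And>j. j \<in> T \<Longrightarrow> 0 \<le> q j" "sum q T = 1"
    and outF: "\<And>i. i \<in> S \<Longrightarrow> sum q {j\<in>T. F i j} \<ge> L"
    and outG: "\<And>j. j \<in> T \<Longrightarrow> sum p {i\<in>S. G j i} \<ge> L"
    and L: "L > 1/3"
  obtains i j i' j' where "i \<in> S" "j \<in> T" "i' \<in> S" "j' \<in> T" "F i j" "G j i'" "F i' j'" "G j' i"
proof (rule ccontr)
  assume "\<not> thesis"
  with that have no4: "\<not> (F i j \<and> G j i' \<and> F i' j' \<and> G j' i)"
    if "i \<in> S" "j \<in> T" "i' \<in> S" "j' \<in> T" for i j i' j' using \<open>i \<in> S\<close> \<open>j \<in> T\<close> \<open>i' \<in> S\<close> \<open>j' \<in> T\<close> by blast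
  \<comment> \<open>Scaling the arcs makes every out-weight exactly \<open>L\<close>.\<close>
  define f where "f i j = (if i \<in> S \<and> F i j then L / sum q {j\<in>T. F i j} else 0)" for i j
  define g where "g j i = (if j \<in> T \<and> G j i then L / sum p {i\<in>S. G j i} else 0)" for i j
  have f01: "0 \<le> f i j" "f i j \<le> 1" for i j
    using outF[of i] L by (auto simp: f_def)
  have g01: "0 \<le> g j i" "g j i \<le> 1" for i j
    using outG[of j] L by (auto simp: g_def)
  have no2: "f i j + g j i \<le> 1" if "i \<in> S" "j \<in> T" for i j
    using no4[OF that that] f01[of i j] g01[of j i] by (cases "F i j") (auto simp: f_def g_def)
  have no4': "f i j * g j i' * f i' j' * g j' i = 0" if "i \<in> S" "j \<in> T" "i' \<in> S" "j' \<in> T" for i j i' j'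
    using no4[OF that] by (auto simp: f_def g_def)
  have outf: "(\<Sum>j\<in>T. q j * f i j) = L" if i: "i \<in> S" for i
  proof -
    have "(\<Sum>j\<in>T. q j * f i j) = (\<Sum>j\<in>{j\<in>T. F i j}. q j * (L / sum q {j\<in>T. F i j}))"
      using fin i by (intro sum.mono_neutral_cong_right) (auto simp: f_def)
    then show ?thesis using outF[OF i] L by (simp add: sum_distrib_right[symmetric] sum_divide_distrib[symmetric])
  qed
  have outg: "(\<Sum>i\<in>S. p i * g j i) = L" if j: "j \<in> T" for j
  proof -
    have "(\<Sum>i\<in>S. p i * g j i) = (\<Sum>i\<in>{i\<in>S. G j i}. p i * (L / sum p {i\<in>S. G j i}))"
      using fin j by (intro sum.mono_neutral_cong_right) (auto simp: g_def)
    then show ?thesis using outG[OF j] L by (simp add: sum_distrib_right[symmetric] sum_divide_distrib[symmetric])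
  qed
  define inS where "inS i = (\<Sum>j\<in>T. q j * g j i)" for i
  define inT where "inT j = (\<Sum>i\<in>S. p i * f i j)" for j
  have ne: "S \<noteq> {}" "T \<noteq> {}" using p(2) q(2) by auto
  obtain i where i: "i \<in> S" "\<And>i'. i' \<in> S \<Longrightarrow> inS i' \<le> inS i"
    using Max_in[of "inS ` S"] Max_ge[of "inS ` S"] fin(1) ne(1) by fastforce
  obtain j where j: "j \<in> T" "\<And>j'. j' \<in> T \<Longrightarrow> inT j' \<le> inT j"
    using Max_in[of "inT ` T"] Max_ge[of "inT ` T"] fin(2) ne(2) by fastforce
  show False
  proof (cases "inT j \<le> inS i")
    case True
    then have "inT j' \<le> inS i" if "j' \<in> T" for j' using j(2)[OF that] by linarith
    then show False
      using bipartite_max_indegree_contradiction[OF fin p(1) q f01(1) g01(1) no2 no4' outf outg L i(1)]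
      by (auto simp: inT_def inS_def)
  next
    case False
    then have le: "inS i' \<le> inT j" if "i' \<in> S" for i' using i(2)[OF that] by linarith
    show False
    proof (rule bipartite_max_indegree_contradiction[where S = T and T = S and f = g and g = f
        and p = q and q = p and i = j])
      fix j i j' i' assume "j \<in> T" "i \<in> S" "j' \<in> T" "i' \<in> S"
      then show "g j i * f i j' * g j' i' * f i' j = 0"
        using no4'[of i' j i j'] by auto
    qed (use fin p q f01 g01 no2 outf outg L j le in \<open>auto simp: inT_def inS_def add.commute\<close>)
  qed
qed

section \<open>Tournaments in which small sets are dominated\<close>

lemma card_subsets_with_trace:
  assumes "finite V" "Y \<subseteq> V" "w \<subseteq> Y"
  shows "card {r\<in>Pow V. r \<inter> Y = w} = 2 ^ (card V - card Y)"
proof -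
  have "bij_betw (\<lambda>s. s \<union> w) (Pow (V - Y)) {r\<in>Pow V. r \<inter> Y = w}"
    by (rule bij_betw_byWitness[where f' = "\<lambda>r. r - Y"]) (use assms in auto)
  then have "card {r\<in>Pow V. r \<inter> Y = w} = card (Pow (V - Y))" by (simp add: bij_betw_same_card)
  also have "\<dots> = 2 ^ (card V - card Y)"
    using assms by (simp add: card_Pow card_Diff_subset finite_subset)
  finally show ?thesis .
qed

text \<open>A tournament is read off from a family of sets \<open>h\<close> by a parity rule. Once the sets \<open>h y\<close>
  with \<open>y \<in> Y\<close> are fixed, whether \<open>x \<notin> Y\<close> dominates \<open>Y\<close> depends only on the trace of \<open>h x\<close>
  on \<open>Y\<close>, so these events are independent over \<open>x\<close>.\<close>

definition parity_beats :: "(nat \<Rightarrow> nat set) \<Rightarrow> nat \<Rightarrow> nat \<Rightarrow> bool" where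
  "parity_beats h x y \<longleftrightarrow> x \<noteq> y \<and> ((y \<in> h x) = ((x \<in> h y) = (x < y)))"

lemma parity_beats_asym: "\<not> (parity_beats h x y \<and> parity_beats h y x)"
  unfolding parity_beats_def by (cases "x < y") auto

text \<open>Choose \<open>h\<close> on \<open>Y\<close> first, in
  \<open>(2 ^ card V) ^ card Y\<close> ways. Each \<open>x\<close> outside \<open>Y\<close> then
  fails to dominate \<open>Y\<close> exactly when \<open>h x\<close> avoids one prescribed trace,
  which \<open>2 ^ (card V - card Y)\<close> subsets of \<open>V\<close> have.\<close>

lemma card_not_dominating:
  fixes V Y :: "nat set"
  assumes V: "finite V" and Y: "Y \<subseteq> V"
  shows "card {h \<in> V \<rightarrow>\<^sub>E Pow V. \<forall>x\<in>V - Y. \<exists>y\<in>Y. \<not> parity_beats h x y}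
    \<le> (2 ^ card V) ^ card Y * (2 ^ card V - 2 ^ (card V - card Y)) ^ (card V - card Y)"
    (is "card ?Bad \<le> _")
proof -
  have fY: "finite Y" using assms finite_subset by blast
  \<comment> \<open>\<open>w h x\<close> is the trace on \<open>Y\<close> with which
    \<open>x\<close> beats all of \<open>Y\<close>; \<open>C h\<close> collects the extensions of
    \<open>h\<close> from \<open>Y\<close> to \<open>V\<close> in which no outside vertex has its
    winning trace.\<close>
  define w where "w h x = {y\<in>Y. (x \<in> h y) = (x < y)}" for h :: "nat \<Rightarrow> nat set" and x
  define C where "C h = (\<Pi>\<^sub>E x\<in>V. if x \<in> Y then {h x} else Pow V - {r\<in>Pow V. r \<inter> Y = w h x})" for h
  have cardC: "card (C h) = (2 ^ card V - 2 ^ (card V - card Y)) ^ (card V - card Y)" for h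
  proof -
    have "card (C h) = (\<Prod>x\<in>V. if x \<in> Y then 1 else 2 ^ card V - 2 ^ (card V - card Y))"
      unfolding C_def card_PiE[OF V]
    proof (rule prod.cong[OF refl])
      fix x
      have "w h x \<subseteq> Y" by (auto simp: w_def)
      then have "card {r\<in>Pow V. r \<inter> Y = w h x} = 2 ^ (card V - card Y)"
        by (rule card_subsets_with_trace[OF V Y])
      moreover have "card (Pow V - {r\<in>Pow V. r \<inter> Y = w h x}) = card (Pow V) - card {r\<in>Pow V. r \<inter> Y = w h x}"
        using V by (intro card_Diff_subset) auto
      ultimately show "card (if x \<in> Y then {h x} else Pow V - {r\<in>Pow V. r \<inter> Y = w h x})
          = (if x \<in> Y then 1 else 2 ^ card V - 2 ^ (card V - card Y))"
        using V by (simp add: card_Pow)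
    qed
    also have "\<dots> = (\<Prod>x\<in>V - Y. 2 ^ card V - 2 ^ (card V - card Y))"
      using V by (intro prod.mono_neutral_cong_right) auto
    finally show ?thesis using Y fY by (simp add: card_Diff_subset)
  qed
  have "?Bad \<subseteq> (\<Union>h \<in> Y \<rightarrow>\<^sub>E Pow V. C h)"
  proof
    fix h assume h: "h \<in> ?Bad"
    have "h \<in> C (restrict h Y)"
      unfolding C_def
    proof (rule PiE_I)
      fix x assume x: "x \<in> V"
      have "h x \<inter> Y \<noteq> w (restrict h Y) x" if "x \<notin> Y"
      proof
        assume eq: "h x \<inter> Y = w (restrict h Y) x"
        have "parity_beats h x y" if y: "y \<in> Y" for y
        proof -
          have "y \<in> h x \<inter> Y \<longleftrightarrow> (x \<in> h y) = (x < y)" unfolding eq using y by (simp add: w_def)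
          then show ?thesis using y \<open>x \<notin> Y\<close> unfolding parity_beats_def by blast
        qed
        then show False using h x \<open>x \<notin> Y\<close> by blast
      qed
      then show "h x \<in> (if x \<in> Y then {restrict h Y x} else Pow V - {r\<in>Pow V. r \<inter> Y = w (restrict h Y) x})"
        using h x by auto
    qed (use h in auto)
    moreover have "restrict h Y \<in> Y \<rightarrow>\<^sub>E Pow V" using h Y by auto
    ultimately show "h \<in> (\<Union>h \<in> Y \<rightarrow>\<^sub>E Pow V. C h)" by blast
  qed
  moreover have finE: "finite (Y \<rightarrow>\<^sub>E Pow V)" using fY V by (intro finite_PiE) auto
  moreover have "finite (C h)" for h unfolding C_def using V by (intro finite_PiE) auto
  ultimately have "card ?Bad \<le> card (\<Union>h \<in> Y \<rightarrow>\<^sub>E Pow V. C h)" by (intro card_mono) auto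
  also have "\<dots> \<le> (\<Sum>h \<in> Y \<rightarrow>\<^sub>E Pow V. card (C h))" by (rule card_UN_le[OF finE])
  also have "\<dots> = (2 ^ card V) ^ card Y * (2 ^ card V - 2 ^ (card V - card Y)) ^ (card V - card Y)"
    using fY V by (simp add: cardC card_PiE card_Pow)
  finally show ?thesis .
qed

text \<open>Union bound over the at most \<open>M ^ K\<close> sets of size \<open>K\<close>: a
  random family is bad for one of them with probability at most
  \<open>(1 - 1 / 2 ^ K) ^ (M - K)\<close>, so \<open>small\<close> leaves a family that is bad for
  none.\<close>

lemma dominating_tournament:
  assumes KM: "K \<le> M" and small: "real M ^ K * (1 - 1 / 2 ^ K) ^ (M - K) < 1"
  obtains D :: "nat \<Rightarrow> nat \<Rightarrow> bool" where "\<And>x y. \<not> (D x y \<and> D y x)"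
    and "\<And>Y. Y \<subseteq> {..<M} \<Longrightarrow> card Y \<le> K \<Longrightarrow> \<exists>x<M. \<forall>y\<in>Y. D x y"
proof -
  define V where "V = {..<M}"
  have V: "finite V" "card V = M" by (auto simp: V_def)
  define YS where "YS = {Y. Y \<subseteq> V \<and> card Y = K}"
  define Bad where "Bad Y = {h \<in> V \<rightarrow>\<^sub>E Pow V. \<forall>x\<in>V - Y. \<exists>y\<in>Y. \<not> parity_beats h x y}" for Y
  have finE: "finite (V \<rightarrow>\<^sub>E Pow V)" using V by (intro finite_PiE) auto
  have finYS: "finite YS" using V by (auto simp: YS_def)
  have cardYS: "card YS \<le> M ^ K"
    using n_subsets[OF V(1), of K] binomial_le_pow[OF KM] V(2) by (simp add: YS_def)
  have badY: "real (card (Bad Y)) \<le> 2 ^ (M * M) * (1 - 1 / 2 ^ K) ^ (M - K)" if "Y \<in> YS" for Y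
  proof -
    have "card (Bad Y) \<le> (2 ^ M) ^ K * (2 ^ M - 2 ^ (M - K)) ^ (M - K)"
      using card_not_dominating[OF V(1), of Y] that V(2) by (simp add: YS_def Bad_def)
    then have "real (card (Bad Y)) \<le> real ((2 ^ M) ^ K * (2 ^ M - 2 ^ (M - K)) ^ (M - K))"
      by (rule of_nat_mono)
    also have "\<dots> = (2 ^ M) ^ K * (2 ^ M - 2 ^ (M - K)) ^ (M - K)"
      by (simp add: of_nat_diff power_increasing)
    also have "(2 ^ M - 2 ^ (M - K) :: real) = 2 ^ M * (1 - 1 / 2 ^ K)"
      using KM by (simp add: power_diff algebra_simps)
    also have "(2 ^ M) ^ K * (2 ^ M * (1 - 1 / 2 ^ K)) ^ (M - K)
        = (2 ^ M) ^ (K + (M - K)) * (1 - 1 / 2 ^ K :: real) ^ (M - K)"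
      by (simp add: power_mult_distrib power_add)
    also have "\<dots> = 2 ^ (M * M) * (1 - 1 / 2 ^ K) ^ (M - K)"
      using KM by (simp add: power_mult)
    finally show ?thesis .
  qed
  have "real (card (\<Union>Y\<in>YS. Bad Y)) \<le> (\<Sum>Y\<in>YS. real (card (Bad Y)))"
    using card_UN_le[OF finYS, of Bad] by (metis of_nat_le_iff of_nat_sum)
  also have "\<dots> \<le> real (card YS) * (2 ^ (M * M) * (1 - 1 / 2 ^ K) ^ (M - K))"
    using sum_bounded_above[of YS, OF badY] by simp
  also have "\<dots> \<le> real M ^ K * (2 ^ (M * M) * (1 - 1 / 2 ^ K) ^ (M - K))"
    using cardYS by (intro mult_right_mono) (auto simp flip: of_nat_power)
  also have "\<dots> < 2 ^ (M * M)" using small by (simp add: mult.left_commute)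
  also have "\<dots> = real (card (V \<rightarrow>\<^sub>E Pow V))" using V by (simp add: card_PiE card_Pow power_mult)
  finally have "card (\<Union>Y\<in>YS. Bad Y) < card (V \<rightarrow>\<^sub>E Pow V)" by simp
  then have "\<not> (V \<rightarrow>\<^sub>E Pow V \<subseteq> (\<Union>Y\<in>YS. Bad Y))"
    using card_mono[of "\<Union>Y\<in>YS. Bad Y" "V \<rightarrow>\<^sub>E Pow V"] finE finYS by (auto simp: Bad_def)
  then obtain h where h: "h \<in> V \<rightarrow>\<^sub>E Pow V" "\<And>Y. Y \<in> YS \<Longrightarrow> h \<notin> Bad Y" by blast
  show thesis
  proof (rule that)
    show "\<not> (parity_beats h x y \<and> parity_beats h y x)" for x y by (rule parity_beats_asym)
    fix Y assume Y: "Y \<subseteq> {..<M}" "card Y \<le> K"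
    \<comment> \<open>A smaller set inherits its dominating vertex from a superset of size
      \<open>K\<close>.\<close>
    obtain Z where "Y \<subseteq> Z" "Z \<subseteq> V" "card Z = K"
      using exists_subset_between[of Y K V] Y V KM by (auto simp: V_def)
    moreover from this obtain x where "x \<in> V" "\<forall>y\<in>Z. parity_beats h x y"
      using h(1) h(2)[of Z] unfolding YS_def Bad_def by blast
    ultimately show "\<exists>x<M. \<forall>y\<in>Y. parity_beats h x y" unfolding V_def by blast
  qed
qed

text \<open>With \<open>M = 16 ^ K\<close> the two factors of the union bound are at most
  \<open>exp (4 * K * K)\<close> and \<open>exp (1 - 8 ^ K)\<close>.\<close>

lemma dominating_tournament_16_pow:
  assumes K: "1 \<le> K"
  obtains D :: "nat \<Rightarrow> nat \<Rightarrow> bool" where "\<And>x y. \<not> (D x y \<and> D y x)"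
    and "\<And>Y. Y \<subseteq> {..<16 ^ K} \<Longrightarrow> card Y \<le> K \<Longrightarrow> \<exists>x<16 ^ K. \<forall>y\<in>Y. D x y"
proof (rule dominating_tournament[of K "16 ^ K"])
  have K2: "K \<le> 2 ^ K" using less_exp[of K] by simp
  also have "(2::nat) ^ K \<le> 16 ^ K" by (simp add: power_mono)
  finally show KM: "K \<le> 16 ^ K" .
  \<comment> \<open>The summand \<open>2\<close> makes the final exponent
    \<open>4 * K * K + (1 - 8 ^ K)\<close> at most \<open>-1\<close>, hence the product strictly
    below 1.\<close>
  have "4 * K * K + 2 \<le> (8::nat) ^ K" using K
  proof (induction K rule: dec_induct)
    case (step n)
    define s where "s = n * n"
    have "n \<le> s" by (simp add: s_def)
    have "4 * Suc n * Suc n + 2 = 4 * s + 8 * n + 6" by (simp add: s_def algebra_simps)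
    also have "\<dots> \<le> 8 * (4 * s + 2)" using \<open>n \<le> s\<close> by simp
    also have "\<dots> \<le> 8 ^ Suc n" using step.IH by (simp add: s_def mult.assoc)
    finally show ?case .
  qed simp
  then have big: "4 * real K * real K + 2 \<le> 8 ^ K"
    by (metis (mono_tags, lifting) of_nat_add of_nat_le_iff of_nat_mult of_nat_numeral of_nat_power)
  have "(1 - 1 / 2 ^ K :: real) \<le> exp (- 1 / 2 ^ K)"
    using exp_ge_add_one_self[of "- 1 / 2 ^ K :: real"] by simp
  then have "(1 - 1 / 2 ^ K :: real) ^ (16 ^ K - K) \<le> exp (- 1 / 2 ^ K) ^ (16 ^ K - K)"
    by (intro power_mono) auto
  also have "\<dots> = exp (real (16 ^ K - K) * (- 1 / 2 ^ K))" by (rule exp_of_nat_mult[symmetric])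
  also have "real (16 ^ K - K) * (- 1 / 2 ^ K) = (real K - 16 ^ K) / 2 ^ K"
    using KM by (simp add: of_nat_diff diff_divide_distrib)
  also have "exp ((real K - 16 ^ K) / 2 ^ K) \<le> exp (1 - 8 ^ K)"
  proof -
    have "real K \<le> 2 ^ K" using K2 by (metis of_nat_le_iff of_nat_numeral of_nat_power)
    moreover have "(16::real) ^ K = 8 ^ K * 2 ^ K" by (simp flip: power_mult_distrib)
    ultimately show ?thesis by (simp add: field_simps)
  qed
  finally have a: "(1 - 1 / 2 ^ K :: real) ^ (16 ^ K - K) \<le> exp (1 - 8 ^ K)" .
  have "(16::real) \<le> exp 4"
  proof -
    have "(2::real) ^ 4 \<le> exp 1 ^ 4" using exp_ge_add_one_self[of "1::real"] by (intro power_mono) auto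
    then show ?thesis by (simp flip: exp_of_nat_mult)
  qed
  then have "(16::real) ^ (K * K) \<le> exp 4 ^ (K * K)" by (rule power_mono) simp
  then have b: "real (16 ^ K) ^ K \<le> exp (4 * real K * real K)"
    by (simp add: power_mult exp_of_nat_mult[symmetric] mult_ac flip: power_mult)
  have "real (16 ^ K) ^ K * (1 - 1 / 2 ^ K) ^ (16 ^ K - K)
      \<le> exp (4 * real K * real K) * exp (1 - 8 ^ K)"
    by (rule mult_mono[OF b a]) auto
  also have "\<dots> = exp (4 * real K * real K + (1 - 8 ^ K))" by (rule exp_add[symmetric])
  also have "\<dots> < 1" using big by simp
  finally show "real (16 ^ K) ^ K * (1 - 1 / 2 ^ K) ^ (16 ^ K - K) < 1" .
qed (use that in blast)

section \<open>The games\<close>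

lemma sum_over_supp:
  assumes "mixed_strategy k p"
  shows "(\<Sum>i<k. p i * (if P i then 1 else 0)) = sum p {i \<in> supp k p. P i}"
proof (rule sum.mono_neutral_cong_right)
  show "\<forall>i\<in>{..<k} - {i \<in> supp k p. P i}. p i * (if P i then 1 else 0) = 0"
  proof
    fix i assume i: "i \<in> {..<k} - {i \<in> supp k p. P i}"
    then have "0 \<le> p i" using assms by (simp add: mixed_strategy_def)
    then show "p i * (if P i then 1 else 0) = 0" using i by (auto simp: supp_def)
  qed
qed (auto simp: supp_def)

lemma mixed_strategy_supp:
  assumes "mixed_strategy k p"
  shows "sum p (supp k p) = 1" "finite (supp k p)" "supp k p \<noteq> {}"
    "\<And>i. i \<in> supp k p \<Longrightarrow> 0 \<le> p i"
proof -
  show "sum p (supp k p) = 1" using sum_over_supp[OF assms, of "\<lambda>_. True"] assms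
    by (simp add: mixed_strategy_def)
  then show "supp k p \<noteq> {}" by auto
qed (auto simp: supp_def)

text \<open>At most \<open>k\<close> columns contain at most \<open>k * k\<close> vertices in total;
  this fixes the size of the sets to be dominated and hence the number of rows.\<close>

lemma game_with_large_supports:
  fixes \<epsilon> :: real
  assumes \<epsilon>: "\<epsilon> < 2 / 3" and k: "1 \<le> k"
  obtains A B where "win_lose (16 ^ (k * k)) ((16 ^ (k * k)) ^ k) A B"
    and "\<And>p q. eps_WSNE \<epsilon> (16 ^ (k * k)) ((16 ^ (k * k)) ^ k) A B p q \<Longrightarrow>
      k < max (card (supp (16 ^ (k * k)) p)) (card (supp ((16 ^ (k * k)) ^ k) q))"
proof -
  define m :: nat where "m = 16 ^ (k * k)"
  define n where "n = m ^ k"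
  from k have "1 \<le> k * k" by simp
  from dominating_tournament_16_pow[OF this] obtain D :: "nat \<Rightarrow> nat \<Rightarrow> bool"
    where asym: "\<And>x y. \<not> (D x y \<and> D y x)"
      and dom: "\<And>Y. Y \<subseteq> {..<m} \<Longrightarrow> card Y \<le> k * k \<Longrightarrow> \<exists>x<m. \<forall>y\<in>Y. D x y"
    unfolding m_def by metis
  \<comment> \<open>Repetitions are allowed, so there are exactly \<open>m ^ k\<close> tuples, and
    padding with one of its own elements turns any nonempty set of at most \<open>k\<close> vertices
    into a column.\<close>
  define LS where "LS = {xs. set xs \<subseteq> {..<m} \<and> length xs = k}"
  have LS: "finite LS" "card LS = n"
    using finite_lists_length_eq[of "{..<m}" k] card_lists_length_eq[of "{..<m}" k]
    by (auto simp: LS_def n_def)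
  obtain e where "bij_betw e {0..<n} LS" using ex_bij_betw_nat_finite[OF LS(1)] LS(2) by blast
  then have e: "e ` {..<n} = LS" by (simp add: bij_betw_def lessThan_atLeast0)
  define Q where "Q j = set (e j)" for j
  have Q: "Q j \<subseteq> {..<m}" "card (Q j) \<le> k" if "j < n" for j
  proof -
    have "e j \<in> LS" using e that by blast
    then show "Q j \<subseteq> {..<m}" "card (Q j) \<le> k" using card_length[of "e j"] by (auto simp: Q_def LS_def)
  qed
  have Q_surj: "\<exists>j<n. X \<subseteq> Q j" if X: "X \<subseteq> {..<m}" "card X \<le> k" "X \<noteq> {}" for X
  proof -
    have "finite X" using X finite_subset by blast
    then obtain xs where xs: "set xs = X" "length xs = card X"
      using finite_distinct_list distinct_card by metis
    obtain x where x: "x \<in> X" using X by blast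
    have "xs @ replicate (k - card X) x \<in> LS" using X xs x by (auto simp: LS_def set_replicate_conv_if)
    then obtain j where j: "j < n" "e j = xs @ replicate (k - card X) x" using e by (metis imageE lessThan_iff)
    then show ?thesis using xs by (auto simp: Q_def)
  qed
  define A where "A i j = (if \<forall>x\<in>Q j. D i x then 1 else 0 :: real)" for i j
  define B where "B i j = (if i \<in> Q j then 1 else 0 :: real)" for i j
  have "win_lose m n A B" by (simp add: win_lose_def A_def B_def)
  moreover have "k < max (card (supp m p)) (card (supp n q))" if eq: "eps_WSNE \<epsilon> m n A B p q" for p q
  proof (rule ccontr)
    assume "\<not> ?thesis"
    then have small: "card (supp m p) \<le> k" "card (supp n q) \<le> k" by auto
    have p: "mixed_strategy m p" and q: "mixed_strategy n q" using eq by (auto simp: eps_WSNE_def)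
    have row: "row_payoff n A q i = sum q {j \<in> supp n q. \<forall>x\<in>Q j. D i x}" for i
      using sum_over_supp[OF q, of "\<lambda>j. \<forall>x\<in>Q j. D i x"]
      unfolding row_payoff_def A_def by (simp add: mult.commute)
    have col: "col_payoff m B p j = sum p {i \<in> supp m p. i \<in> Q j}" for j
      using sum_over_supp[OF p, of "\<lambda>i. i \<in> Q j"] unfolding col_payoff_def B_def by simp
    have "card (\<Union>j\<in>supp n q. Q j) \<le> (\<Sum>j\<in>supp n q. card (Q j))"
      by (rule card_UN_le) (rule mixed_strategy_supp[OF q])
    also have "\<dots> \<le> card (supp n q) * k"
      using sum_bounded_above[of "supp n q" "\<lambda>j. card (Q j)" k] Q(2) by (auto simp: supp_def)
    also have "\<dots> \<le> k * k" using small by simp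
    finally obtain l where l: "l < m" "\<And>j x. j \<in> supp n q \<Longrightarrow> x \<in> Q j \<Longrightarrow> D l x"
      using dom[of "\<Union>j\<in>supp n q. Q j"] Q(1) by (fastforce simp: supp_def)
    have "{j \<in> supp n q. \<forall>x\<in>Q j. D l x} = supp n q" using l by blast
    then have "row_payoff n A q l = 1" using mixed_strategy_supp[OF q] by (simp add: row)
    then have rows: "sum q {j \<in> supp n q. \<forall>x\<in>Q j. D i x} \<ge> 1 - \<epsilon>" if "i \<in> supp m p" for i
      using eq that l(1) by (force simp: eps_WSNE_def simp flip: row)
    obtain c where c: "c < n" "supp m p \<subseteq> Q c"
      using Q_surj[of "supp m p"] small mixed_strategy_supp[OF p] by (auto simp: supp_def)
    have "{i \<in> supp m p. i \<in> Q c} = supp m p" using c by blast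
    then have "col_payoff m B p c = 1" using mixed_strategy_supp[OF p] by (simp add: col)
    then have cols: "sum p {i \<in> supp m p. i \<in> Q j} \<ge> 1 - \<epsilon>" if "j \<in> supp n q" for j
      using eq that c(1) by (force simp: eps_WSNE_def simp flip: col)
    have "1 - \<epsilon> > 1 / 3" using \<epsilon> by simp
    from mixed_strategy_supp(2)[OF p] mixed_strategy_supp(2)[OF q]
      mixed_strategy_supp(4)[OF p] mixed_strategy_supp(1)[OF p]
      mixed_strategy_supp(4)[OF q] mixed_strategy_supp(1)[OF q] rows cols this
    show False
    proof (rule bipartite_closed_4_walk)
      fix i j i' j'
      \<comment> \<open>Since \<open>i\<close> beats all of \<open>Q j\<close> and \<open>i'\<close>
        lies in it, \<open>D i i'\<close> holds; the other half of the walk gives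
        \<open>D i' i\<close>.\<close>
      assume "\<forall>x\<in>Q j. D i x" "i' \<in> Q j" "\<forall>x\<in>Q j'. D i' x" "i \<in> Q j'"
      then show False using asym by blast
    qed
  qed
  ultimately show thesis using that unfolding n_def m_def by blast
qed

theorem theorem1:
  fixes \<epsilon> :: real
  assumes "\<epsilon> < 2 / 3"
  shows "\<exists>c > 0. \<forall>N :: nat. \<exists>m n A B.
           1 \<le> m \<and> m \<le> n \<and> N \<le> n \<and> win_lose m n A B \<and>
           (\<forall>p q. eps_WSNE \<epsilon> m n A B p q \<longrightarrow>
              real (max (card (supp m p)) (card (supp n q))) \<ge> c * root 3 (ln (real n)))"
proof (intro exI[of _ "1 / 2 :: real"] conjI allI)
  fix N :: nat
  \<comment> \<open>The summand 1 keeps \<open>k\<close> positive when \<open>N = 0\<close>; the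
    game is large enough because \<open>N \<le> 2 ^ k \<le> n\<close>.\<close>
  define k where "k = N + 1"
  define m :: nat where "m = 16 ^ (k * k)"
  define n where "n = m ^ k"
  have k: "1 \<le> k" by (simp add: k_def)
  have m2: "2 \<le> m" using k power_increasing[of 1 "k * k" "16::nat"] by (simp add: m_def)
  have "m \<le> n" using k m2 power_increasing[of 1 k m] by (simp add: n_def)
  have "N \<le> 2 ^ k" using less_exp[of k] by (simp add: k_def)
  also have "\<dots> \<le> n" unfolding n_def using m2 by (rule power_mono) simp
  finally have "N \<le> n" .
  \<comment> \<open>The bound 8 is taken because it is a cube:
    \<open>ln (real n) = k ^ 3 * ln 16\<close> is then at most \<open>(2 * k) ^ 3\<close>, which
    yields the constant \<open>1 / 2\<close>.\<close>
  have "(16::real) \<le> exp 8"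
  proof -
    have "(2::real) ^ 4 \<le> exp 2 ^ 4" using exp_ge_add_one_self[of "2::real"] by (intro power_mono) auto
    then show ?thesis by (simp flip: exp_of_nat_mult)
  qed
  then have "ln (16::real) \<le> 8" by (metis exp_gt_zero ln_exp ln_le_cancel_iff zero_less_numeral)
  moreover have "ln (real n) = real k ^ 3 * ln 16"
    by (simp add: n_def m_def ln_realpow power3_eq_cube)
  ultimately have "ln (real n) \<le> real k ^ 3 * 8" by (simp add: mult_left_mono)
  then have "ln (real n) \<le> (2 * real k) ^ 3" by (simp add: power_mult_distrib)
  then have "root 3 (ln (real n)) \<le> root 3 ((2 * real k) ^ 3)"
    by (intro real_root_le_mono) simp_all
  also have "\<dots> = 2 * real k" by (rule real_root_power_cancel) auto
  finally have root: "1 / 2 * root 3 (ln (real n)) \<le> real k" by simp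
  obtain A B where AB: "win_lose m n A B"
    "\<And>p q. eps_WSNE \<epsilon> m n A B p q \<Longrightarrow> k < max (card (supp m p)) (card (supp n q))"
    using game_with_large_supports[OF assms k] unfolding n_def m_def by metis
  show "\<exists>m n A B. 1 \<le> m \<and> m \<le> n \<and> N \<le> n \<and> win_lose m n A B \<and>
     (\<forall>p q. eps_WSNE \<epsilon> m n A B p q \<longrightarrow>
        real (max (card (supp m p)) (card (supp n q))) \<ge> 1 / 2 * root 3 (ln (real n)))"
  proof (intro exI conjI allI impI)
    fix p q assume "eps_WSNE \<epsilon> m n A B p q"
    then have "real k \<le> real (max (card (supp m p)) (card (supp n q)))" using AB(2) by (meson less_imp_le of_nat_mono)
    with root show "1 / 2 * root 3 (ln (real n)) \<le> real (max (card (supp m p)) (card (supp n q)))" by linarith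
  qed (use m2 \<open>m \<le> n\<close> \<open>N \<le> n\<close> AB(1) in auto)
qed simp

end
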